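(* Let $\mathcal{X}$ be an infinite dimensional separable complex Banach space, let $T$ be a quasinilpotent bounded linear operator on $\mathcal{X}$, and let $p$ be a polynomial with complex coefficients of degree $n=\deg(p)\geq 2$ such that its derivative $p'$ has a non-zero root of multiplicity $n-1$. Then $T$ has a nontrivial closed invariant subspace if and only if $p(T)$ has a nontrivial closed invariant subspace.
   Context: An operator $T$ is quasinilpotent if its spectrum is $\sigma(T)=\{0\}$. A closed linear subspace is invariant for an operator if the operator maps it into itself; it is nontrivial if it is neither $\{0\}$ nor the whole space. *)

theory Defs
  imports "HOL-Analysis.Analysis" "HOL-Computational_Algebra.Polynomial"
begin

text \<open>A complex Banach space is a real Banach space carrying a complex scalar multiplication that
  extends the real one and with respect to which the norm is homogeneous.\<close>

class complex_banach = banach +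
  fixes scaleC :: "complex \<Rightarrow> 'a \<Rightarrow> 'a" (infixr "*\<^sub>C" 75)
  assumes scaleC_add_right: "c *\<^sub>C (x + y) = c *\<^sub>C x + c *\<^sub>C y"
    and scaleC_add_left: "(c + d) *\<^sub>C x = c *\<^sub>C x + d *\<^sub>C x"
    and scaleC_scaleC: "c *\<^sub>C d *\<^sub>C x = (c * d) *\<^sub>C x"
    and scaleR_scaleC: "r *\<^sub>R x = complex_of_real r *\<^sub>C x"
    and norm_scaleC: "norm (c *\<^sub>C x) = cmod c * norm x"

instantiation complex :: complex_banach
begin

definition scaleC_complex :: "complex \<Rightarrow> complex \<Rightarrow> complex"
  where "scaleC_complex c x = c * x"

instance
  by standard (simp_all add: scaleC_complex_def algebra_simps norm_mult scaleR_conv_of_real)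

end

global_interpretation complex_vector:
  vector_space "scaleC :: complex \<Rightarrow> 'a \<Rightarrow> 'a::complex_banach"
proof
  show "1 *\<^sub>C x = x" for x :: 'a
    using scaleR_scaleC[of 1 x] by simp
qed (simp_all add: scaleC_add_right scaleC_add_left scaleC_scaleC)

definition bounded_clinear :: "('a::complex_banach \<Rightarrow> 'b::complex_banach) \<Rightarrow> bool"
  where "bounded_clinear T \<longleftrightarrow> bounded_linear T \<and> (\<forall>c x. T (c *\<^sub>C x) = c *\<^sub>C T x)"

definition infinite_dimensional :: "'a::complex_banach itself \<Rightarrow> bool"
  where "infinite_dimensional TYPE('a) \<longleftrightarrow>
    \<not> (\<exists>B :: 'a set. finite B \<and> complex_vector.span B = UNIV)"

definition op_spectrum :: "('a::complex_banach \<Rightarrow> 'a) \<Rightarrow> complex set"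
  where "op_spectrum T =
    {z. \<not> (\<exists>S. bounded_clinear S \<and>
              (\<forall>x. S (T x - z *\<^sub>C x) = x) \<and> (\<forall>x. T (S x) - z *\<^sub>C S x = x))}"

definition quasinilpotent :: "('a::complex_banach \<Rightarrow> 'a) \<Rightarrow> bool"
  where "quasinilpotent T \<longleftrightarrow> op_spectrum T = {0}"

definition poly_op :: "complex poly \<Rightarrow> ('a::complex_banach \<Rightarrow> 'a) \<Rightarrow> 'a \<Rightarrow> 'a"
  where "poly_op p T = (\<lambda>x. \<Sum>i\<le>degree p. coeff p i *\<^sub>C (T ^^ i) x)"

definition has_nontrivial_closed_invariant_subspace :: "('a::complex_banach \<Rightarrow> 'a) \<Rightarrow> bool"
  where "has_nontrivial_closed_invariant_subspace T \<longleftrightarrow>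
    (\<exists>M. complex_vector.subspace M \<and> closed M \<and> T ` M \<subseteq> M \<and> M \<noteq> {0} \<and> M \<noteq> UNIV)"

end

theory Submission
  imports Defs
begin

text \<open>The hypothesis on \<open>p'\<close> says that \<open>p' = c (X - a)^(n - 1)\<close> with \<open>a \<noteq> 0\<close>, hence \<open>p'(0) \<noteq> 0\<close>.
  For a quasinilpotent \<open>T\<close> and any polynomial \<open>p\<close> with \<open>p'(0) \<noteq> 0\<close>, the operators \<open>T\<close> and \<open>p(T)\<close>
  have the same closed invariant subspaces, because \<open>p\<close> is invertible near the spectrum \<open>{0}\<close>, so
  that \<open>T\<close> is a norm limit of polynomials in \<open>p(T)\<close>.

  Such polynomials come from a fixed point iteration. After rescaling, \<open>p = X + h\<close> with \<open>h'(0) = 0\<close>,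
  so that \<open>X\<close> is a fixed point of \<open>f \<mapsto> p - h \<circ> f\<close>, and the iterates \<open>t k\<close> starting at \<open>0\<close> are
  polynomials in \<open>p\<close>. With respect to the norm \<open>wnorm r\<close>, which sends \<open>\<Sum>i. c i X^i\<close> to
  \<open>\<Sum>i. |c i| r^i\<close>, composition with \<open>h\<close> is Lipschitz on a ball of radius \<open>\<rho>\<close> with the constant
  \<open>\<Sum>i. i |h i| \<rho>^(i - 1)\<close> (lemma \<open>wnorm_pcompose_diff\<close>), which is small for small \<open>\<rho>\<close> because
  \<open>h'(0) = 0\<close>. Hence \<open>t k\<close> converges to \<open>X\<close> in \<open>wnorm r\<close> for some \<open>r > 0\<close>.

  This convergence passes to operators once \<open>\<parallel>T^k\<parallel> \<le> C r^k\<close>, since then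
  \<open>\<parallel>f(T)\<parallel> \<le> C wnorm r f\<close> (lemma \<open>poly_op_wnorm\<close>). Such a \<open>C\<close> exists for every \<open>r > 0\<close> by the
  spectral radius formula (lemma \<open>quasinilpotent_power_bound\<close>). The formula is proved without vector
  valued complex analysis, by averaging the resolvent over the \<open>n\<close>-th roots of unity, which gives the
  inverse of \<open>1 - r^n T^n\<close>.\<close>

section \<open>Polynomials of an operator\<close>

lemma poly_op_bound:
  assumes "degree f \<le> n"
  shows "poly_op f T x = (\<Sum>i\<le>n. coeff f i *\<^sub>C (T ^^ i) x)"
  unfolding poly_op_def
  by (rule sum.mono_neutral_left) (use assms in \<open>auto simp: coeff_eq_0\<close>)

lemma poly_op_add: "poly_op (f + g) T x = poly_op f T x + poly_op g T x"
  using degree_add_le_max[of f g]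
  by (simp add: poly_op_bound[where n = "max (degree f) (degree g)"]
      scaleC_add_left sum.distrib)

lemma poly_op_smult: "poly_op (smult c f) T x = c *\<^sub>C poly_op f T x"
  using degree_smult_le[of c f]
  by (simp add: poly_op_bound[where n = "degree f"] complex_vector.scale_sum_right)

lemma poly_op_diff: "poly_op (f - g) T x = poly_op f T x - poly_op g T x"
  using poly_op_add[of f "smult (-1) g" T x] poly_op_smult[of "-1" g T x] by simp

lemma poly_op_0: "poly_op 0 T x = 0"
  by (simp add: poly_op_def)

lemma poly_op_X: "poly_op [:0, 1:] T x = T x"
  by (simp add: poly_op_def)

lemma poly_op_pCons:
  assumes "bounded_clinear T"
  shows "poly_op (pCons a f) T x = a *\<^sub>C x + T (poly_op f T x)"
proof -
  interpret bounded_linear T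
    using assms by (simp add: bounded_clinear_def)
  have "poly_op (pCons a f) T x =
      (\<Sum>i\<le>Suc (degree f). coeff (pCons a f) i *\<^sub>C (T ^^ i) x)"
    by (intro poly_op_bound degree_pCons_le)
  also have "\<dots> = a *\<^sub>C x + (\<Sum>i\<le>degree f. coeff f i *\<^sub>C T ((T ^^ i) x))"
    by (subst sum.atMost_Suc_shift) simp
  also have "\<dots> = a *\<^sub>C x + T (poly_op f T x)"
    using assms by (simp add: poly_op_def sum bounded_clinear_def)
  finally show ?thesis .
qed

lemma poly_op_mult:
  assumes "bounded_clinear T"
  shows "poly_op (f * g) T x = poly_op f T (poly_op g T x)"
proof (induction f)
  case (pCons a f)
  then show ?case
    by (simp add: poly_op_pCons[OF assms] poly_op_add poly_op_smult)
qed (simp add: poly_op_0)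

lemma poly_op_invariant:
  assumes "complex_vector.subspace M" and "T ` M \<subseteq> M" and "x \<in> M"
  shows "poly_op f T x \<in> M"
proof -
  have "(T ^^ i) x \<in> M" for i
    using assms(2,3) by (induction i) auto
  then show ?thesis
    unfolding poly_op_def
    by (intro complex_vector.subspace_sum complex_vector.subspace_scale assms(1))
qed

lemma poly_op_pcompose_invariant:
  assumes T: "bounded_clinear T" and M: "complex_vector.subspace M"
    and f: "poly_op f T ` M \<subseteq> M"
  shows "poly_op (pcompose h f) T ` M \<subseteq> M"
proof (induction h)
  case 0
  then show ?case
    using M by (auto simp: poly_op_0 complex_vector.subspace_0)
next
  case (pCons a h)
  have "poly_op (pcompose (pCons a h) f) T x \<in> M" if "x \<in> M" for x
  proof -
    have "poly_op f T (poly_op (pcompose h f) T x) \<in> M"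
      using pCons f that by blast
    moreover have "poly_op [:a:] T x = a *\<^sub>C x"
      by (simp add: poly_op_def)
    ultimately show ?thesis
      using M that
      by (simp add: pcompose_pCons poly_op_add poly_op_mult[OF T]
          complex_vector.subspace_add complex_vector.subspace_scale)
  qed
  then show ?case by blast
qed

section \<open>A weighted norm on polynomials\<close>

text \<open>The real polynomial \<open>majorant f\<close> dominates \<open>f\<close> coefficientwise. It turns estimates of the weighted
  norm into evaluations of real polynomials with nonnegative coefficients.\<close>

definition majorant :: "complex poly \<Rightarrow> real poly"
  where "majorant = map_poly cmod"

definition wnorm :: "real \<Rightarrow> complex poly \<Rightarrow> real"
  where "wnorm r f = poly (majorant f) r"

lemma coeff_majorant [simp]: "coeff (majorant f) i = cmod (coeff f i)"
  by (simp add: majorant_def coeff_map_poly)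

lemma majorant_pCons: "majorant (pCons a f) = pCons (cmod a) (majorant f)"
  by (rule poly_eqI) (simp add: coeff_pCons split: nat.split)

lemma majorant_0 [simp]: "majorant 0 = 0"
  by (rule poly_eqI) simp

lemma poly_mono_coeff:
  fixes F G :: "real poly"
  assumes "\<And>i. coeff F i \<le> coeff G i" and "r \<ge> 0"
  shows "poly F r \<le> poly G r"
proof -
  have "0 \<le> poly (G - F) r"
    unfolding poly_altdef using assms by (intro sum_nonneg) auto
  then show ?thesis by simp
qed

lemma wnorm_nonneg: "r \<ge> 0 \<Longrightarrow> wnorm r f \<ge> 0"
  unfolding wnorm_def using poly_mono_coeff[of 0 "majorant f" r] by simp

lemma wnorm_add: "r \<ge> 0 \<Longrightarrow> wnorm r (f + g) \<le> wnorm r f + wnorm r g"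
  unfolding wnorm_def poly_add[symmetric]
  by (rule poly_mono_coeff) (simp_all add: norm_triangle_ineq)

lemma wnorm_minus: "wnorm r (f - g) = wnorm r (g - f)"
proof -
  have "majorant (f - g) = majorant (g - f)"
    by (rule poly_eqI) (simp add: norm_minus_commute)
  then show ?thesis by (simp add: wnorm_def)
qed

lemma wnorm_mult:
  assumes "r \<ge> 0"
  shows "wnorm r (f * g) \<le> wnorm r f * wnorm r g"
  unfolding wnorm_def poly_mult[symmetric]
proof (rule poly_mono_coeff[OF _ assms])
  fix i
  show "coeff (majorant (f * g)) i \<le> coeff (majorant f * majorant g) i"
    by (simp add: coeff_mult norm_mult[symmetric] norm_sum)
qed

lemma poly_majorant_nonneg:
  assumes "0 \<le> r"
  shows "0 \<le> poly (majorant h) r" and "0 \<le> poly (pderiv (majorant h)) r"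
proof -
  show "0 \<le> poly (majorant h) r"
    using wnorm_nonneg[OF assms, of h] by (simp add: wnorm_def)
  show "0 \<le> poly (pderiv (majorant h)) r"
    unfolding poly_altdef using assms by (intro sum_nonneg) (auto simp: coeff_pderiv)
qed

lemma wnorm_pcompose:
  assumes "r \<ge> 0" and "wnorm r f \<le> \<rho>"
  shows "wnorm r (pcompose h f) \<le> poly (majorant h) \<rho>"
proof (induction h)
  case (pCons a h)
  have "wnorm r (pcompose (pCons a h) f) \<le> wnorm r [:a:] + wnorm r (f * pcompose h f)"
    using wnorm_add[OF assms(1)] by (simp add: pcompose_pCons)
  also have "\<dots> \<le> cmod a + wnorm r f * wnorm r (pcompose h f)"
    using wnorm_mult[OF assms(1)] by (simp add: wnorm_def majorant_pCons)
  also have "\<dots> \<le> cmod a + \<rho> * poly (majorant h) \<rho>"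
    using assms pCons wnorm_nonneg[OF assms(1)]
    by (intro add_left_mono mult_mono) (auto intro: order_trans)
  finally show ?case
    by (simp add: majorant_pCons)
qed (simp add: wnorm_def)

text \<open>Composition with \<open>h\<close> satisfies a mean value inequality in the weighted norm, with the derivative
  of the majorant in place of the derivative. Horner's scheme for \<open>h\<close> reduces the inequality to
  \<open>f u - g v = f (u - v) + v (f - g)\<close>, where \<open>u\<close> and \<open>v\<close> are \<open>h \<circ> f\<close> and \<open>h \<circ> g\<close>; this matches
  the recursion \<open>(X h)' = X h' + h\<close> for the derivative.\<close>

lemma wnorm_pcompose_diff:
  assumes "r \<ge> 0" and "wnorm r f \<le> \<rho>" and "wnorm r g \<le> \<rho>"
  shows "wnorm r (pcompose h f - pcompose h g) \<le> poly (pderiv (majorant h)) \<rho> * wnorm r (f - g)"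
proof (induction h)
  case (pCons a h)
  have \<rho>: "0 \<le> \<rho>"
    using assms(2) wnorm_nonneg[OF assms(1), of f] by linarith
  have "wnorm r (pcompose (pCons a h) f - pcompose (pCons a h) g)
      = wnorm r (f * (pcompose h f - pcompose h g) + pcompose h g * (f - g))"
    by (simp add: pcompose_pCons algebra_simps)
  also have "\<dots> \<le> wnorm r f * wnorm r (pcompose h f - pcompose h g)
      + wnorm r (pcompose h g) * wnorm r (f - g)"
    by (intro order_trans[OF wnorm_add] add_mono wnorm_mult assms(1))
  also have "\<dots> \<le> \<rho> * (poly (pderiv (majorant h)) \<rho> * wnorm r (f - g))
      + poly (majorant h) \<rho> * wnorm r (f - g)"
    using assms \<rho> pCons
    by (intro add_mono mult_mono wnorm_pcompose wnorm_nonneg mult_nonneg_nonneg poly_majorant_nonneg) auto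
  finally show ?case
    by (simp add: majorant_pCons pderiv_pCons algebra_simps)
qed (simp add: wnorm_def)

lemma poly_op_wnorm:
  assumes "\<And>k x. norm ((T ^^ k) x) \<le> C * r ^ k * norm x"
  shows "norm (poly_op f T x) \<le> C * wnorm r f * norm x"
proof -
  have deg: "degree (majorant f) = degree f"
    unfolding majorant_def by (rule degree_map_poly) simp
  have "norm (poly_op f T x) \<le> (\<Sum>i\<le>degree f. cmod (coeff f i) * (C * r ^ i * norm x))"
    unfolding poly_op_def
    by (intro sum_norm_le) (use assms in \<open>auto simp: norm_scaleC intro: mult_left_mono\<close>)
  also have "\<dots> = C * wnorm r f * norm x"
    by (simp add: wnorm_def poly_altdef deg sum_distrib_left sum_distrib_right algebra_simps)
  finally show ?thesis .
qed


section \<open>Growth of the powers of a quasinilpotent operator\<close>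

text \<open>Here \<open>R z\<close> is the inverse of \<open>1 - z T\<close>. Compared with the resolvent at \<open>1 / z\<close>, this form is regular
  at \<open>z = 0\<close>, and for quasinilpotent \<open>T\<close> it is defined on the whole complex plane.\<close>

locale entire_resolvent =
  fixes T :: "'a::complex_banach \<Rightarrow> 'a" and R :: "complex \<Rightarrow> 'a \<Rightarrow> 'a"
  assumes T: "bounded_clinear T"
    and R: "bounded_clinear (R z)"
    and R_left: "R z (x - z *\<^sub>C T x) = x"
    and R_right: "R z x - z *\<^sub>C T (R z x) = x"
begin

sublocale T: bounded_linear T
  using T by (simp add: bounded_clinear_def)

sublocale R: bounded_linear "R z" for z
  using R by (simp add: bounded_clinear_def)

lemma T_scaleC: "T (c *\<^sub>C x) = c *\<^sub>C T x"
  and R_scaleC: "R z (c *\<^sub>C x) = c *\<^sub>C R z x"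
  using T R by (simp_all add: bounded_clinear_def)

lemma R_T_commute: "R z (T x) = T (R z x)"
proof -
  have "T x = T (R z x) - z *\<^sub>C T (T (R z x))"
    using R_right[of z x] by (metis T.diff T_scaleC)
  then show ?thesis
    using R_left[of z "T (R z x)"] by simp
qed

lemma R_power_commute: "R z ((T ^^ k) x) = (T ^^ k) (R z x)"
  by (induction k) (simp_all add: R_T_commute)

lemma resolvent_identity: "R z x - R w x = (z - w) *\<^sub>C R z (T (R w x))"
proof -
  define y where "y = R w x"
  have "R z x - R w x = R z (y - w *\<^sub>C T y) - R z (y - z *\<^sub>C T y)"
    using R_right[of w x] R_left[of z y] by (simp add: y_def)
  also have "\<dots> = (z - w) *\<^sub>C R z (T y)"
    by (simp add: R.diff R_scaleC complex_vector.scale_left_diff_distrib)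
  finally show ?thesis by (simp add: y_def)
qed

text \<open>The resolvent identity bounds \<open>\<parallel>R z x\<parallel>\<close> by \<open>\<parallel>R w x\<parallel>\<close> plus a multiple of \<open>|z - w| \<parallel>R z x\<parallel>\<close>; for \<open>z\<close>
  close to \<open>w\<close> the latter is absorbed into the left-hand side.\<close>

lemma R_locally_bounded:
  obtains \<delta> M where "\<delta> > 0" and "M > 0"
    and "\<And>z x. z \<in> ball w \<delta> \<Longrightarrow> norm (R z x) \<le> M * norm x"
proof -
  obtain K where K: "K > 0" "\<And>x. norm (T x) \<le> K * norm x"
    using T.pos_bounded by (auto simp: mult.commute)
  obtain m where m: "m > 0" "\<And>x. norm (R w x) \<le> m * norm x"
    using R.pos_bounded[of w] by (auto simp: mult.commute)
  have "norm (R z x) \<le> (2 * m) * norm x" if "z \<in> ball w (1 / (2 * K * m))" for z x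
  proof -
    have "cmod (w - z) * (m * K) \<le> 1 / (2 * K * m) * (m * K)"
      using that K m by (intro mult_right_mono) (auto simp: dist_norm)
    then have half: "cmod (w - z) * (m * K) \<le> 1 / 2"
      using K m by simp
    have "norm (R w (T (R z x))) \<le> m * (K * norm (R z x))"
      using m(2)[of "T (R z x)"] K(2)[of "R z x"] m(1)
      by (meson mult_left_mono less_imp_le order_trans)
    then have "cmod (w - z) * norm (R w (T (R z x))) \<le> cmod (w - z) * (m * (K * norm (R z x)))"
      by (intro mult_left_mono) auto
    also have "\<dots> \<le> 1 / 2 * norm (R z x)"
      using mult_right_mono[OF half, of "norm (R z x)"] by (simp add: algebra_simps)
    finally have "norm (R w x - R z x) \<le> 1 / 2 * norm (R z x)"
      by (simp add: resolvent_identity[of w x z] norm_scaleC)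
    moreover have "norm (R z x) \<le> norm (R w x) + norm (R w x - R z x)"
      by (metis norm_minus_commute norm_triangle_sub)
    ultimately show ?thesis
      using m(2)[of x] by linarith
  qed
  then show thesis
    using that[of "1 / (2 * K * m)" "2 * m"] K m by simp
qed

lemma R_bounded_on_cball:
  obtains M where "M > 0" and "\<And>z x. z \<in> cball 0 \<rho> \<Longrightarrow> norm (R z x) \<le> M * norm x"
proof -
  have "\<exists>\<delta> M. \<delta> > 0 \<and> M > 0 \<and> (\<forall>z\<in>ball w \<delta>. \<forall>x. norm (R z x) \<le> M * norm x)" for w
    using R_locally_bounded[of w] by metis
  then obtain \<delta> m where \<delta>: "\<And>w. \<delta> w > 0" and m: "\<And>w. m w > 0"
    and bound: "\<And>w z x. z \<in> ball w (\<delta> w) \<Longrightarrow> norm (R z x) \<le> m w * norm x"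
    by metis
  have "cball 0 \<rho> \<subseteq> (\<Union>w\<in>UNIV. ball w (\<delta> w))"
    using \<delta> centre_in_ball by blast
  then obtain D where D: "finite D" "cball 0 \<rho> \<subseteq> (\<Union>w\<in>D. ball w (\<delta> w))"
    using compactE_image[OF compact_cball, of UNIV "\<lambda>w. ball w (\<delta> w)" 0 \<rho>] open_ball
    by metis
  have "norm (R z x) \<le> (1 + sum m D) * norm x" if z: "z \<in> cball 0 \<rho>" for z x
  proof -
    obtain w where w: "w \<in> D" "z \<in> ball w (\<delta> w)"
      using subsetD[OF D(2) z] by blast
    have "m w \<le> sum m D"
      using w(1) D(1) m by (intro member_le_sum) (auto intro: less_imp_le)
    then have "m w * norm x \<le> (1 + sum m D) * norm x"
      by (intro mult_right_mono) auto
    then show ?thesis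
      using bound[OF w(2), of x] by linarith
  qed
  moreover have "1 + sum m D > 0"
    using sum_nonneg[of D m] m by (smt (verit))
  ultimately show thesis
    using that by blast
qed

lemma R_lipschitz_on_cball:
  obtains L where "L > 0"
    and "\<And>z w x. z \<in> cball 0 \<rho> \<Longrightarrow> w \<in> cball 0 \<rho> \<Longrightarrow>
      norm (R z x - R w x) \<le> L * cmod (z - w) * norm x"
proof -
  obtain K where K: "K > 0" "\<And>x. norm (T x) \<le> K * norm x"
    using T.pos_bounded by (auto simp: mult.commute)
  obtain M where M: "M > 0" "\<And>z x. z \<in> cball 0 \<rho> \<Longrightarrow> norm (R z x) \<le> M * norm x"
    using R_bounded_on_cball by metis
  have "norm (R z x - R w x) \<le> (M * K * M) * cmod (z - w) * norm x"
    if "z \<in> cball 0 \<rho>" "w \<in> cball 0 \<rho>" for z w x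
  proof -
    have "norm (R z (T (R w x))) \<le> M * (K * (M * norm x))"
      using M(2)[OF that(1), of "T (R w x)"] K(2)[of "R w x"] M(2)[OF that(2), of x] M(1) K(1)
      by (meson mult_left_mono less_imp_le order_trans)
    then have "cmod (z - w) * norm (R z (T (R w x))) \<le> cmod (z - w) * (M * (K * (M * norm x)))"
      by (intro mult_left_mono) auto
    then show ?thesis
      by (simp add: resolvent_identity[of z x w] norm_scaleC mult_ac)
  qed
  then show thesis
    using that[of "M * K * M"] K M by simp
qed

text \<open>From \<open>1 / (1 - x^n) = (1 / n) (\<Sum>j<n. 1 / (1 - \<omega>^j x))\<close> for a primitive \<open>n\<close>-th root of unity \<open>\<omega>\<close>, the
  average of the resolvent over the points \<open>\<omega>^j r\<close> is the inverse of \<open>1 - r^n T^n\<close>. It inherits the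
  Lipschitz constant of the resolvent, uniformly in \<open>n\<close>.\<close>

definition R_avg :: "nat \<Rightarrow> real \<Rightarrow> 'a \<Rightarrow> 'a"
  where "R_avg n r x = of_real (1 / n) *\<^sub>C (\<Sum>j<n. R (cis (2 * pi / n) ^ j * of_real r) x)"

lemma R_telescope: "R z (x - z ^ n *\<^sub>C (T ^^ n) x) = (\<Sum>k<n. z ^ k *\<^sub>C (T ^^ k) x)"
proof -
  define y where "y = (\<Sum>k<n. z ^ k *\<^sub>C (T ^^ k) x)"
  have "x - z ^ n *\<^sub>C (T ^^ n) x = (\<Sum>k<n. z ^ k *\<^sub>C (T ^^ k) x - z ^ Suc k *\<^sub>C (T ^^ Suc k) x)"
    using sum_lessThan_telescope'[of "\<lambda>k. z ^ k *\<^sub>C (T ^^ k) x" n] by simp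
  also have "\<dots> = y - z *\<^sub>C T y"
    by (simp add: y_def sum_subtractf T.sum T_scaleC complex_vector.scale_sum_right)
  finally show ?thesis
    by (simp add: R_left y_def)
qed

lemma power_power_swap: "(x ^ j) ^ k = (x ^ k) ^ j" for x :: complex
  by (simp add: mult.commute flip: power_mult)

lemma cis_root_power: "n > 0 \<Longrightarrow> cis (2 * pi / real n) ^ n = 1"
  by (simp add: Complex.DeMoivre)

lemma sum_powers_root_of_unity:
  fixes n k :: nat
  assumes "k < n"
  shows "(\<Sum>j<n. (cis (2 * pi / n) ^ j) ^ k) = (if k = 0 then of_nat n else 0)"
proof (cases "k = 0")
  case False
  define \<omega> where "\<omega> = cis (2 * pi / n) ^ k"
  have "\<omega> \<noteq> 1"
  proof
    assume "\<omega> = 1"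
    then have "cis (2 * pi * real k / real n) = cis (2 * pi * real 0 / real n)"
      by (simp add: \<omega>_def Complex.DeMoivre mult_ac)
    moreover have "inj_on (\<lambda>j. cis (2 * pi * real j / real n)) {..<n}"
      using Complex.bij_betw_roots_unity[of n] assms by (auto simp: bij_betw_def)
    ultimately have "k = 0"
      using assms by (intro inj_onD[of "\<lambda>j. cis (2 * pi * real j / real n)" "{..<n}" k 0]) auto
    then show False
      using False by simp
  qed
  moreover have "\<omega> ^ n = 1"
    using assms by (simp add: \<omega>_def power_power_swap[of _ k n] cis_root_power)
  ultimately have "(\<Sum>j<n. \<omega> ^ j) = 0"
    by (simp add: geometric_sum)
  then show ?thesis
    using False by (simp add: \<omega>_def power_mult[symmetric] mult.commute)
qed simp

lemma R_avg_left:
  assumes "n > 0"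
  shows "R_avg n r (x - of_real (r ^ n) *\<^sub>C (T ^^ n) x) = x"
proof -
  define \<zeta> where "\<zeta> j = cis (2 * pi / n) ^ j * of_real r" for j
  have \<zeta>: "\<zeta> j ^ n = of_real (r ^ n)" for j
    using cis_root_power[OF assms]
    by (simp add: \<zeta>_def power_mult_distrib power_power_swap[of _ j n])
  have "(\<Sum>j<n. R (\<zeta> j) (x - of_real (r ^ n) *\<^sub>C (T ^^ n) x)) =
      (\<Sum>j<n. \<Sum>k<n. \<zeta> j ^ k *\<^sub>C (T ^^ k) x)"
    by (intro sum.cong refl) (metis R_telescope \<zeta>)
  also have "\<dots> = (\<Sum>k<n. (\<Sum>j<n. \<zeta> j ^ k) *\<^sub>C (T ^^ k) x)"
    by (subst sum.swap) (simp add: complex_vector.scale_sum_left)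
  also have "\<dots> = (\<Sum>k<n. if k = 0 then of_nat n *\<^sub>C x else 0)"
  proof (intro sum.cong refl)
    fix k assume "k \<in> {..<n}"
    then show "(\<Sum>j<n. \<zeta> j ^ k) *\<^sub>C (T ^^ k) x = (if k = 0 then of_nat n *\<^sub>C x else 0)"
      using sum_powers_root_of_unity[of k n]
      by (simp add: \<zeta>_def power_mult_distrib sum_distrib_right[symmetric])
  qed
  also have "\<dots> = of_nat n *\<^sub>C x"
    using assms by simp
  finally show ?thesis
    using assms by (simp add: R_avg_def \<zeta>_def)
qed

lemma R_avg_right:
  assumes "n > 0"
  shows "R_avg n r x - of_real (r ^ n) *\<^sub>C (T ^^ n) (R_avg n r x) = x"
proof -
  have lin: "(T ^^ k) (\<Sum>j\<in>J. f j) = (\<Sum>j\<in>J. (T ^^ k) (f j))"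
    "(T ^^ k) (c *\<^sub>C y) = c *\<^sub>C (T ^^ k) y" for k c y and f :: "nat \<Rightarrow> 'a" and J
    by (induction k) (simp_all add: T.sum T_scaleC)
  have "R_avg n r x - of_real (r ^ n) *\<^sub>C (T ^^ n) (R_avg n r x) =
      R_avg n r (x - of_real (r ^ n) *\<^sub>C (T ^^ n) x)"
    by (simp add: R_avg_def lin R.diff R_scaleC R_power_commute sum_subtractf
        complex_vector.scale_sum_right complex_vector.scale_right_diff_distrib mult.commute)
  then show ?thesis
    using R_avg_left[OF assms] by simp
qed

lemma R_avg_lipschitz:
  assumes L: "\<And>z w x. z \<in> cball 0 \<rho> \<Longrightarrow> w \<in> cball 0 \<rho> \<Longrightarrow>
      norm (R z x - R w x) \<le> L * cmod (z - w) * norm x"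
    and "n > 0" "0 \<le> s" "s \<le> r" "r \<le> \<rho>"
  shows "norm (R_avg n r x - R_avg n s x) \<le> L * (r - s) * norm x"
proof -
  have diff: "R_avg n r x - R_avg n s x = of_real (1 / n) *\<^sub>C
      (\<Sum>j<n. R (cis (2 * pi / n) ^ j * of_real r) x - R (cis (2 * pi / n) ^ j * of_real s) x)"
    by (simp add: R_avg_def sum_subtractf complex_vector.scale_right_diff_distrib)
  have "norm (R (cis (2 * pi / n) ^ j * of_real r) x - R (cis (2 * pi / n) ^ j * of_real s) x)
      \<le> L * (r - s) * norm x" for j
  proof -
    have "cmod (cis (2 * pi / n) ^ j * of_real r - cis (2 * pi / n) ^ j * of_real s) = r - s"
      using assms
      by (simp add: right_diff_distrib[symmetric] norm_mult norm_power flip: of_real_diff)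
    then show ?thesis
      using L[of "cis (2 * pi / n) ^ j * of_real r" "cis (2 * pi / n) ^ j * of_real s" x] assms
      by (simp add: norm_mult norm_power)
  qed
  then have "norm (\<Sum>j<n. R (cis (2 * pi / n) ^ j * of_real r) x
      - R (cis (2 * pi / n) ^ j * of_real s) x) \<le> (\<Sum>j<n. L * (r - s) * norm x)"
    by (intro sum_norm_le) auto
  then show ?thesis
    using \<open>n > 0\<close> by (simp add: diff norm_scaleC norm_divide field_simps)
qed

text \<open>If \<open>s^n T^n\<close> is small, then the inverse \<open>R_avg n s\<close> of \<open>1 - s^n T^n\<close> is close to \<open>1\<close>. For \<open>r\<close> close to
  \<open>s\<close>, in a sense that does not depend on \<open>n\<close>, also \<open>R_avg n r\<close> is close to \<open>1\<close>, and therefore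
  \<open>r^n T^n\<close> is still fairly small.\<close>

lemma power_bound_step:
  assumes L: "\<And>z w x. z \<in> cball 0 \<rho> \<Longrightarrow> w \<in> cball 0 \<rho> \<Longrightarrow>
      norm (R z x - R w x) \<le> L * cmod (z - w) * norm x"
    and n: "n > 0" and s: "0 \<le> s" "s \<le> r" "r \<le> \<rho>" "L * (r - s) \<le> 1 / 8"
    and E: "\<And>x. s ^ n * norm ((T ^^ n) x) \<le> 1 / 8 * norm x"
  shows "r ^ n * norm ((T ^^ n) x) \<le> 1 / 2 * norm x"
proof -
  have A: "norm (R_avg n r x - x) \<le> 1 / 3 * norm x" for x
  proof -
    define y where "y = R_avg n s x"
    have "y - x = of_real (s ^ n) *\<^sub>C (T ^^ n) y"
      using R_avg_right[OF n, of s x] by (simp add: y_def algebra_simps)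
    then have "norm (y - x) \<le> 1 / 8 * norm y"
      using E[of y] s by (simp add: norm_scaleC norm_power)
    moreover have "norm y \<le> norm x + norm (y - x)"
      by (metis norm_triangle_sub)
    moreover have "norm (R_avg n r x - y) \<le> 1 / 8 * norm x"
    proof -
      have "norm (R_avg n r x - y) \<le> L * (r - s) * norm x"
        unfolding y_def by (rule R_avg_lipschitz[OF L n s(1-3)])
      also have "\<dots> \<le> 1 / 8 * norm x"
        using s(4) by (intro mult_right_mono) auto
      finally show ?thesis .
    qed
    moreover have "norm (R_avg n r x - x) \<le> norm (R_avg n r x - y) + norm (y - x)"
      by (metis add_diff_eq diff_add_cancel norm_triangle_ineq)
    ultimately show ?thesis
      using norm_ge_zero[of x] by linarith
  qed
  define e where "e = of_real (r ^ n) *\<^sub>C (T ^^ n) x"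
  have diff: "R_avg n r (x - e) = R_avg n r x - R_avg n r e"
    by (simp add: R_avg_def R.diff sum_subtractf complex_vector.scale_right_diff_distrib)
  then have "R_avg n r x - x = R_avg n r e"
    using R_avg_left[OF n, of r x] by (simp add: e_def algebra_simps)
  then have "norm e \<le> norm (R_avg n r x - x) + norm (R_avg n r e - e)"
    by (metis norm_minus_commute norm_triangle_sub)
  then have "norm e \<le> 1 / 2 * norm x"
    using A[of x] A[of e] by linarith
  then show ?thesis
    using s by (simp add: e_def norm_scaleC norm_power)
qed

text \<open>The bound moves from \<open>s\<close> to \<open>s + \<delta> / 2\<close> with \<open>\<delta>\<close> depending only on \<open>\<rho>\<close>, so that finitely many
  steps lead from \<open>0\<close> to \<open>\<rho>\<close>. The previous lemma at \<open>s + \<delta>\<close> only gives the weaker constant \<open>1 / 2\<close>;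
  going back to \<open>s + \<delta> / 2\<close> gains a geometric factor, which restores \<open>1 / 8\<close> for large \<open>n\<close>.\<close>

lemma eventually_power_bound:
  assumes "\<rho> > 0"
  shows "\<forall>\<^sub>F n in sequentially. \<forall>x. \<rho> ^ n * norm ((T ^^ n) x) \<le> 1 / 8 * norm x"
proof -
  define P where "P s \<longleftrightarrow>
    (\<forall>\<^sub>F n in sequentially. \<forall>x. s ^ n * norm ((T ^^ n) x) \<le> 1 / 8 * norm x)" for s
  \<comment> \<open>The radius is doubled because the steps look ahead by \<open>\<delta> \<le> \<rho>\<close>.\<close>
  obtain L where L: "L > 0" "\<And>z w x. z \<in> cball 0 (2 * \<rho>) \<Longrightarrow> w \<in> cball 0 (2 * \<rho>) \<Longrightarrow>
      norm (R z x - R w x) \<le> L * cmod (z - w) * norm x"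
    using R_lipschitz_on_cball by metis
  define \<delta> where "\<delta> = min (1 / (8 * L)) \<rho>"
  have \<delta>: "\<delta> > 0" "\<delta> \<le> \<rho>" "L * \<delta> \<le> 1 / 8"
    using L assms by (auto simp: \<delta>_def min_def field_simps)
  have step: "P r" if "P s" "0 \<le> s" "s \<le> r" "r \<le> s + \<delta> / 2" "r \<le> \<rho>" for s r
  proof -
    define t where "t = s + \<delta>"
    have t: "t > 0" "t \<le> 2 * \<rho>" "r / t < 1" "0 \<le> r / t" "norm (r / t) < 1"
      using that \<delta> by (auto simp: t_def)
    have "(\<lambda>n. (r / t) ^ n) \<longlonglongrightarrow> 0"
      using t by (intro LIMSEQ_power_zero)
    then have "\<forall>\<^sub>F n in sequentially. (r / t) ^ n < 1 / 4"
      by (rule order_tendstoD) simp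
    moreover have "\<forall>\<^sub>F n in sequentially. n > 0"
      by (rule eventually_gt_at_top)
    ultimately show ?thesis
      using that(1) unfolding P_def
    proof eventually_elim
      case (elim n)
      show ?case
      proof
        fix x
        have half: "t ^ n * norm ((T ^^ n) x) \<le> 1 / 2 * norm x"
        proof (rule power_bound_step[OF L(2) elim(2)])
          show "0 \<le> s" "s \<le> t" "t \<le> 2 * \<rho>" "L * (t - s) \<le> 1 / 8"
            using t that \<delta> by (simp_all add: t_def)
        qed (use elim(3) in blast)+
        have "r ^ n * norm ((T ^^ n) x) = (r / t) ^ n * (t ^ n * norm ((T ^^ n) x))"
          using t by (simp add: power_divide)
        also have "\<dots> \<le> 1 / 4 * (1 / 2 * norm x)"
        proof (rule mult_mono)
          show "(r / t) ^ n \<le> 1 / 4"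
            using elim(1) by simp
        qed (use half t in auto)
        finally show "r ^ n * norm ((T ^^ n) x) \<le> 1 / 8 * norm x"
          by simp
      qed
    qed
  qed
  have all_steps: "P (min \<rho> (real k * (\<delta> / 2)))" for k
  proof (induction k)
    case 0
    have "\<forall>\<^sub>F n in sequentially. (n::nat) > 0"
      by (rule eventually_gt_at_top)
    then have "P 0"
      unfolding P_def by (rule eventually_mono) (simp add: zero_power)
    then show ?case
      using assms by simp
  next
    case (Suc k)
    show ?case
      by (rule step[OF Suc]) (use \<delta> assms in \<open>auto simp: min_def field_simps\<close>)
  qed
  obtain k where "\<rho> < real k * (\<delta> / 2)"
    using ex_less_of_nat_mult[of "\<delta> / 2" \<rho>] \<delta> by auto
  then have "P \<rho>"
    using all_steps[of k] by simp
  then show ?thesis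
    unfolding P_def .
qed

end

text \<open>The eventual bound for the radius \<open>1 / r\<close> controls all but finitely many powers; the
  constant \<open>C\<close> absorbs the others.\<close>

lemma quasinilpotent_power_bound:
  assumes T: "bounded_clinear T" and "quasinilpotent T" and "r > 0"
  obtains C where "C > 0" and "\<And>k x. norm ((T ^^ k) x) \<le> C * r ^ k * norm x"
proof -
  interpret T: bounded_linear T
    using T by (simp add: bounded_clinear_def)
  have "\<exists>S. bounded_clinear S \<and> (\<forall>x. S (x - z *\<^sub>C T x) = x) \<and> (\<forall>x. S x - z *\<^sub>C T (S x) = x)" for z
  proof (cases "z = 0")
    case True
    have "bounded_clinear (\<lambda>x::'a. x)"
      by (simp add: bounded_clinear_def bounded_linear_ident)
    then show ?thesis
      using True by (intro exI[of _ "\<lambda>x. x"]) simp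
  next
    case False
    then have "inverse z \<notin> op_spectrum T"
      using assms(2) by (simp add: quasinilpotent_def)
    then obtain S where S: "bounded_clinear S" "\<And>x. S (T x - inverse z *\<^sub>C x) = x"
      "\<And>x. T (S x) - inverse z *\<^sub>C S x = x"
      unfolding op_spectrum_def by blast
    interpret S: bounded_linear S
      using S by (simp add: bounded_clinear_def)
    have S_scaleC: "S (c *\<^sub>C x) = c *\<^sub>C S x" and T_scaleC: "T (c *\<^sub>C x) = c *\<^sub>C T x" for c x
      using S(1) T by (simp_all add: bounded_clinear_def)
    \<comment> \<open>\<open>1 - z T = - z (T - 1 / z)\<close>\<close>
    define S' where "S' x = S ((- inverse z) *\<^sub>C x)" for x
    have "bounded_linear (\<lambda>x::'a. (- inverse z) *\<^sub>C x)"
      by (rule bounded_linear_intro[where K = "cmod (inverse z)"])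
        (simp_all add: scaleC_add_right scaleR_scaleC norm_scaleC mult.commute)
    then have "bounded_clinear S'"
      unfolding S'_def bounded_clinear_def
      by (intro conjI bounded_linear_compose[OF S.bounded_linear_axioms])
        (simp_all only: S_scaleC scaleC_scaleC mult.commute, simp)
    moreover have "S' (x - z *\<^sub>C T x) = x" for x
    proof -
      have "(- inverse z) *\<^sub>C (x - z *\<^sub>C T x) = T x - inverse z *\<^sub>C x"
        using False by (simp add: complex_vector.scale_right_diff_distrib)
      then show ?thesis by (simp add: S'_def S(2))
    qed
    moreover have "S' x - z *\<^sub>C T (S' x) = x" for x
    proof -
      define y where "y = (- inverse z) *\<^sub>C x"
      have "S' x - z *\<^sub>C T (S' x) = (- z) *\<^sub>C (T (S y) - inverse z *\<^sub>C S y)"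
        unfolding S'_def y_def[symmetric]
        using False by (simp add: complex_vector.scale_right_diff_distrib)
      also have "\<dots> = x"
        using False by (simp add: S(3) y_def)
      finally show ?thesis .
    qed
    ultimately show ?thesis by blast
  qed
  then obtain R where R: "\<And>z. bounded_clinear (R z)" "\<And>z x. R z (x - z *\<^sub>C T x) = x"
    "\<And>z x. R z x - z *\<^sub>C T (R z x) = x"
    by metis
  interpret entire_resolvent T R
    by standard (use T R in auto)
  obtain N where N: "\<And>n x. n \<ge> N \<Longrightarrow> inverse r ^ n * norm ((T ^^ n) x) \<le> 1 / 8 * norm x"
    using eventually_power_bound[of "inverse r"] \<open>r > 0\<close>
    by (auto simp: eventually_sequentially)
  obtain K where K: "K > 0" "\<And>x. norm (T x) \<le> K * norm x"
    using T.pos_bounded by (auto simp: mult.commute)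
  have pow: "norm ((T ^^ k) x) \<le> K ^ k * norm x" for k x
  proof (induction k)
    case (Suc k)
    have "norm ((T ^^ Suc k) x) \<le> K * norm ((T ^^ k) x)"
      using K(2) by simp
    also have "\<dots> \<le> K * (K ^ k * norm x)"
      using Suc K(1) by (intro mult_left_mono) auto
    finally show ?case
      by (simp add: mult.assoc)
  qed simp
  define C where "C = 1 + (\<Sum>k<N. (K / r) ^ k)"
  have nonneg: "0 \<le> (\<Sum>k<N. (K / r) ^ k)"
    using K(1) \<open>r > 0\<close> by (intro sum_nonneg) auto
  have "norm ((T ^^ k) x) \<le> C * r ^ k * norm x" for k x
  proof (cases "k < N")
    case True
    then have "(K / r) ^ k \<le> (\<Sum>k<N. (K / r) ^ k)"
      using K(1) \<open>r > 0\<close> by (intro member_le_sum) auto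
    then have "(K / r) ^ k * r ^ k * norm x \<le> C * r ^ k * norm x"
      using \<open>r > 0\<close> by (intro mult_right_mono) (auto simp: C_def)
    then show ?thesis
      using pow[of k x] \<open>r > 0\<close> by (simp add: power_divide)
  next
    case False
    then have "norm ((T ^^ k) x) \<le> 1 / 8 * r ^ k * norm x"
      using N[of k x] \<open>r > 0\<close> by (simp add: field_simps)
    also have "\<dots> \<le> C * r ^ k * norm x"
      using nonneg \<open>r > 0\<close> by (intro mult_right_mono) (auto simp: C_def)
    finally show ?thesis .
  qed
  then show thesis
    using that[of C] nonneg by (simp add: C_def)
qed

section \<open>Recovering an operator from a polynomial of it\<close>

text \<open>This is the contraction argument: the iterates \<open>t k\<close> are polynomials in \<open>p\<close>, so \<open>t k\<close> applied to \<open>T\<close>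
  leaves \<open>M\<close> invariant, and these operators converge to \<open>T\<close>.\<close>

lemma invariant_of_poly_op_invariant:
  assumes T: "bounded_clinear T" "quasinilpotent T"
    and M: "complex_vector.subspace M" "closed M"
    and p: "coeff p 1 \<noteq> 0" "poly_op p T ` M \<subseteq> M"
  shows "T ` M \<subseteq> M"
proof -
  define q where "q = smult (inverse (coeff p 1)) p"
  define h where "h = q - [:0, 1:]"
  have q: "poly_op q T ` M \<subseteq> M"
    using p(2) M(1) by (auto simp: q_def poly_op_smult intro!: complex_vector.subspace_scale)
  have "poly (pderiv (majorant h)) 0 = 0"
    using p(1) by (simp add: poly_0_coeff_0 coeff_pderiv h_def q_def)
  moreover have "isCont (poly (pderiv (majorant h))) 0"
    by simp
  ultimately have "\<forall>\<^sub>F s in at 0. poly (pderiv (majorant h)) s < 1 / 2"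
    by (intro order_tendstoD(2)[where y = 0]) (auto simp: isCont_def)
  then obtain d where d: "d > 0" "\<And>s. s \<noteq> 0 \<Longrightarrow> dist s 0 < d \<Longrightarrow> poly (pderiv (majorant h)) s < 1 / 2"
    by (auto simp: eventually_at)
  \<comment> \<open>Then \<open>2 * r < d\<close>; the iterates stay in the ball of radius \<open>2 * r\<close>, since \<open>X\<close> has norm \<open>r\<close> and their
    distance to \<open>X\<close> is at most \<open>r\<close>.\<close>
  define r where "r = d / 4"
  have r: "r > 0" "poly (pderiv (majorant h)) (2 * r) \<le> 1 / 2"
    using d(1) d(2)[of "2 * r"] by (auto simp: r_def)
  define t where "t k = ((\<lambda>f. q - pcompose h f) ^^ k) 0" for k
  have err: "wnorm r (t k - [:0, 1:]) \<le> r / 2 ^ k" for k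
  proof (induction k)
    case 0
    then show ?case
      using r by (simp add: t_def wnorm_def majorant_pCons)
  next
    case (Suc k)
    have X: "wnorm r [:0, 1:] = r"
      by (simp add: wnorm_def majorant_pCons)
    have "r / 2 ^ k \<le> r"
      using r by (simp add: field_simps)
    then have "wnorm r (t k) \<le> 2 * r"
      using wnorm_add[of r "t k - [:0, 1:]" "[:0, 1:]"] Suc X r by simp
    have "t (Suc k) - [:0, 1:] = pcompose h [:0, 1:] - pcompose h (t k)"
      by (simp add: t_def h_def pcompose_diff pcompose_idR)
    then have "wnorm r (t (Suc k) - [:0, 1:])
        \<le> poly (pderiv (majorant h)) (2 * r) * wnorm r ([:0, 1:] - t k)"
      using wnorm_pcompose_diff[of r "[:0, 1:]" "2 * r" "t k" h] X r \<open>wnorm r (t k) \<le> 2 * r\<close> by simp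
    also have "\<dots> \<le> 1 / 2 * (r / 2 ^ k)"
      using r Suc wnorm_nonneg[of r] by (intro mult_mono) (auto simp: wnorm_minus[of r "[:0, 1:]" "t k"])
    finally show ?case by simp
  qed
  have inv: "poly_op (t k) T ` M \<subseteq> M" for k
  proof (induction k)
    case 0
    then show ?case
      using M(1) by (auto simp: t_def poly_op_0 complex_vector.subspace_0)
  next
    case (Suc k)
    then have "poly_op (pcompose h (t k)) T ` M \<subseteq> M"
      by (rule poly_op_pcompose_invariant[OF T(1) M(1)])
    then show ?case
      using q M(1) by (auto simp: t_def poly_op_diff intro!: complex_vector.subspace_diff)
  qed
  obtain C where C: "C > 0" "\<And>k x. norm ((T ^^ k) x) \<le> C * r ^ k * norm x"
    using quasinilpotent_power_bound[OF T r(1)] by metis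
  have "T x \<in> M" if "x \<in> M" for x
  proof -
    have "norm (poly_op (t k) T x - T x) \<le> C * r * norm x * (1 / 2) ^ k" for k
    proof -
      have "norm (poly_op (t k) T x - T x) \<le> C * wnorm r (t k - [:0, 1:]) * norm x"
        using poly_op_wnorm[OF C(2), of "t k - [:0, 1:]" x] by (simp add: poly_op_diff poly_op_X)
      also have "\<dots> \<le> C * (r / 2 ^ k) * norm x"
        using C(1) err by (intro mult_right_mono mult_left_mono) auto
      finally show ?thesis
        by (simp add: power_divide)
    qed
    moreover have "(\<lambda>k. C * r * norm x * (1 / 2) ^ k) \<longlonglongrightarrow> 0"
      by (intro tendsto_mult_right_zero LIMSEQ_power_zero) auto
    ultimately have "(\<lambda>k. poly_op (t k) T x - T x) \<longlonglongrightarrow> 0"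
      by (rule Lim_null_comparison[OF always_eventually[OF allI]])
    then have lim: "(\<lambda>k. poly_op (t k) T x) \<longlonglongrightarrow> T x"
      by (simp only: LIM_zero_iff)
    have "poly_op (t k) T x \<in> M" for k
      using inv that by blast
    then show ?thesis
      by (rule closed_sequentially[OF M(2) _ lim])
  qed
  then show ?thesis by blast
qed

text \<open>A root of order \<open>degree p - 1\<close> exhausts the degree of \<open>p'\<close>, so that \<open>p'\<close> is a constant multiple of
  \<open>(X - a)^(degree p - 1)\<close>.\<close>

lemma coeff_1_nonzero_if_pderiv_root_of_full_order:
  fixes p :: "complex poly"
  assumes "degree p \<ge> 2" and "a \<noteq> 0" and "order a (pderiv p) = degree p - 1"
  shows "coeff p 1 \<noteq> 0"
proof
  assume "coeff p 1 = 0"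
  then have root: "poly (pderiv p) 0 = 0"
    by (simp add: poly_0_coeff_0 coeff_pderiv)
  have nz: "pderiv p \<noteq> 0"
    using assms(1) by (auto simp: pderiv_eq_0_iff)
  define m where "m = order a (pderiv p)"
  obtain u where u: "pderiv p = [:- a, 1:] ^ m * u"
    using order_1[of a "pderiv p"] unfolding m_def by (rule dvdE)
  then have "u \<noteq> 0"
    using nz by auto
  then have "degree (pderiv p) = m + degree u"
    by (simp add: u degree_mult_eq degree_linear_power)
  moreover have "degree (pderiv p) = m"
    using assms(3) by (simp add: degree_pderiv m_def)
  ultimately obtain c where c: "u = [:c:]" "c \<noteq> 0"
    using \<open>u \<noteq> 0\<close> by (metis add_cancel_right_right degree_eq_zeroE pCons_0_0)
  then have "poly (pderiv p) 0 = (- a) ^ m * c"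
    by (simp add: u)
  then show False
    using root assms(2) c(2) by simp
qed

theorem corollary2p3:
  fixes T :: "'a::complex_banach \<Rightarrow> 'a" and p :: "complex poly"
  assumes "infinite_dimensional TYPE('a)"
    and "separable_space (euclidean :: 'a topology)"
    and "bounded_clinear T"
    and "quasinilpotent T"
    and "degree p \<ge> 2"
    and "\<exists>a. a \<noteq> 0 \<and> poly (pderiv p) a = 0 \<and> order a (pderiv p) = degree p - 1"
  shows "has_nontrivial_closed_invariant_subspace T \<longleftrightarrow>
    has_nontrivial_closed_invariant_subspace (poly_op p T)"
proof -
  have "coeff p 1 \<noteq> 0"
    using assms(5,6) coeff_1_nonzero_if_pderiv_root_of_full_order by blast
  then have "T ` M \<subseteq> M \<longleftrightarrow> poly_op p T ` M \<subseteq> M"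
    if "complex_vector.subspace M" "closed M" for M
    using invariant_of_poly_op_invariant[OF assms(3,4) that] poly_op_invariant[OF that(1)]
    by blast
  then show ?thesis
    unfolding has_nontrivial_closed_invariant_subspace_def by blast
qed

end
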